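(* Let $a,b,c\in\mathbb{R}$ with $a\neq 0$, let $g:\mathbb{R}\to\mathbb{R}$, $g(x)=ax^2+bx+c$, and let $\delta:=b^2-4ac-2b-7$. The number of 3-cycles of the quadratic map $x_{t+1}=g(x_t)$ depends on the sign of $\delta$ as follows: (i) If $\delta<0$, the quadratic map has no 3-cycles. (ii) If $\delta=0$, the quadratic map has a unique 3-cycle, denoted by $\mathcal{C}_{\langle 0\rangle}$. The points of $\mathcal{C}_{\langle 0\rangle}$ are $x^{\langle 0\rangle}_i=\frac{-b+1}{2a}+\frac{1}{a\,q^{\langle 0\rangle}_i}$, $i\in\{1,2,3\}$. (iii) If $\delta>0$, the quadratic map has exactly two 3-cycles, denoted by $\mathcal{C}_{\langle\delta\rangle}$ and $\mathcal{C}_{\langle-\delta\rangle}$. The points of $\mathcal{C}_{\langle\delta\rangle}$ are $x^{\langle\delta\rangle}_i=\frac{-b+\sqrt{\delta}+1}{2a}+\frac{1}{a\,q^{\langle\sqrt{\delta}\rangle}_i}$, $i\in\{1,2,3\}$. The points of $\mathcal{C}_{\langle-\delta\rangle}$ are $x^{\langle-\delta\rangle}_i=\frac{-b-\sqrt{\delta}+1}{2a}+\frac{1}{a\,q^{\langle-\sqrt{\delta}\rangle}_i}$, $i\in\{1,2,3\}$.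
   Context: A 3-cycle of the map $x_{t+1}=g(x_t)$ is the class, modulo cyclic permutation, of an ordered triple $(x,y,z)$ of pairwise distinct real numbers with $g(x)=y$, $g(y)=z$, $g(z)=x$; its points are $x,y,z$. For $\beta\in\mathbb{R}$ let $Q_\beta(X)=X^3+(1-\beta)X^2-(2+\beta)X-1$. All roots of $Q_\beta$ are real and distinct; they are denoted $q^{\langle\beta\rangle}_1<q^{\langle\beta\rangle}_2<q^{\langle\beta\rangle}_3$ (and satisfy $q^{\langle\beta\rangle}_1<-1<q^{\langle\beta\rangle}_2<0<q^{\langle\beta\rangle}_3$). *)

theory Defs
  imports Complex_Main "HOL-Computational_Algebra.Polynomial"
begin

definition cyc3_triples :: "(real \<Rightarrow> real) \<Rightarrow> (real \<times> real \<times> real) set" where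
  "cyc3_triples g =
     {(x, y, z). x \<noteq> y \<and> y \<noteq> z \<and> z \<noteq> x \<and> g x = y \<and> g y = z \<and> g z = x}"

definition cyclic_rel :: "((real \<times> real \<times> real) \<times> (real \<times> real \<times> real)) set" where
  "cyclic_rel = {((x, y, z), t) | x y z t. t \<in> {(x, y, z), (y, z, x), (z, x, y)}}"

definition three_cycles :: "(real \<Rightarrow> real) \<Rightarrow> (real \<times> real \<times> real) set set" where
  "three_cycles g = cyc3_triples g // cyclic_rel"

definition cycle_points :: "(real \<times> real \<times> real) set \<Rightarrow> real set" where
  "cycle_points C = (\<Union>(x, y, z)\<in>C. {x, y, z})"

definition Q :: "real \<Rightarrow> real poly" where
  "Q \<beta> = [:- 1, - (2 + \<beta>), 1 - \<beta>, 1:]"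

text \<open>The roots of \<open>Q \<beta>\<close> in increasing order, indexed by \<open>i = 1, 2, 3\<close>;
  see \<open>qroot_roots\<close> and \<open>qroot_order\<close> below.\<close>

definition qroot :: "real \<Rightarrow> nat \<Rightarrow> real" where
  "qroot \<beta> i = sorted_list_of_set {x. poly (Q \<beta>) x = 0} ! (i - 1)"

lemma equiv_cyclic_rel: "equiv UNIV cyclic_rel"
  by (rule equivI) (auto simp: cyclic_rel_def refl_on_def sym_def trans_def)

lemma poly_Q: "poly (Q \<beta>) x = x^3 + (1 - \<beta>) * x^2 - (2 + \<beta>) * x - 1"
  by (simp add: Q_def algebra_simps power2_eq_square power3_eq_cube)

lemma Q_roots:
  obtains r s t where "r < -1" "-1 < s" "s < 0" "0 < t" "{x. poly (Q \<beta>) x = 0} = {r, s, t}"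
proof -
  define M where "M = \<bar>\<beta>\<bar> + 3"
  have M: "M \<ge> 3" "\<beta> \<le> M - 3" "- \<beta> \<le> M - 3" by (auto simp: M_def)
  have v1: "poly (Q \<beta>) (-1) = 1" by (simp add: poly_Q)
  have v0: "poly (Q \<beta>) 0 = -1" by (simp add: poly_Q)
  have up: "poly (Q \<beta>) M > 0"
  proof -
    have "poly (Q \<beta>) M = M * (M * (M + 1 - \<beta>) - 2 - \<beta>) - 1"
      by (simp add: poly_Q algebra_simps power2_eq_square power3_eq_cube)
    moreover have "M * (M + 1 - \<beta>) \<ge> M * 4" by (intro mult_left_mono) (use M in linarith)+
    then have "M * (M + 1 - \<beta>) - 2 - \<beta> \<ge> 1" using M by linarith
    then have "M * (M * (M + 1 - \<beta>) - 2 - \<beta>) \<ge> M * 1" by (intro mult_left_mono) (use M in linarith)+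
    ultimately show ?thesis using M by linarith
  qed
  have low: "poly (Q \<beta>) (- M) < 0"
  proof -
    have "poly (Q \<beta>) (- M) = - (M * (M * (M - 1 + \<beta>) - 2 - \<beta>)) - 1"
      by (simp add: poly_Q algebra_simps power2_eq_square power3_eq_cube)
    moreover have "M * (M - 1 + \<beta>) \<ge> M * 2" by (intro mult_left_mono) (use M in linarith)+
    then have "M * (M - 1 + \<beta>) - 2 - \<beta> \<ge> 1" using M by linarith
    then have "M * (M * (M - 1 + \<beta>) - 2 - \<beta>) \<ge> M * 1" by (intro mult_left_mono) (use M in linarith)+
    ultimately show ?thesis using M by linarith
  qed
  obtain r where r: "- M < r" "r < -1" "poly (Q \<beta>) r = 0"
    using poly_IVT_pos[of "- M" "-1" "Q \<beta>"] low v1 M by force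
  obtain s where s: "-1 < s" "s < 0" "poly (Q \<beta>) s = 0"
    using poly_IVT_neg[of "-1" 0 "Q \<beta>"] v0 v1 by force
  obtain t where t: "0 < t" "t < M" "poly (Q \<beta>) t = 0"
    using poly_IVT_pos[of 0 M "Q \<beta>"] up v0 M by force
  have nz: "Q \<beta> \<noteq> 0" by (simp add: Q_def)
  have "degree (Q \<beta>) = 3" by (simp add: Q_def)
  then have "card {x. poly (Q \<beta>) x = 0} \<le> 3" using card_poly_roots_bound[OF nz] by simp
  moreover have "card {r, s, t} = 3" using r s t by auto
  moreover have "{r, s, t} \<subseteq> {x. poly (Q \<beta>) x = 0}" using r s t by auto
  ultimately have "{r, s, t} = {x. poly (Q \<beta>) x = 0}"
    using poly_roots_finite[OF nz] by (metis card_seteq)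
  with r s t that show ?thesis by metis
qed

lemma qroot_props:
  shows qroot_roots: "{x. poly (Q \<beta>) x = 0} = {qroot \<beta> 1, qroot \<beta> 2, qroot \<beta> 3}"
    and qroot_order: "qroot \<beta> 1 < -1" "-1 < qroot \<beta> 2" "qroot \<beta> 2 < 0" "0 < qroot \<beta> 3"
proof -
  obtain r s t where *: "r < -1" "-1 < s" "s < 0" "0 < t" "{x. poly (Q \<beta>) x = 0} = {r, s, t}"
    by (rule Q_roots)
  have "sorted_list_of_set (set [r, s, t]) = [r, s, t]"
    using *(1-4) by (intro sorted_list_of_set.idem_if_sorted_distinct) auto
  then have "qroot \<beta> 1 = r" "qroot \<beta> 2 = s" "qroot \<beta> 3 = t"
    using * by (simp_all add: qroot_def numeral_2_eq_2 numeral_3_eq_3)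
  with * show "{x. poly (Q \<beta>) x = 0} = {qroot \<beta> 1, qroot \<beta> 2, qroot \<beta> 3}"
    "qroot \<beta> 1 < -1" "-1 < qroot \<beta> 2" "qroot \<beta> 2 < 0" "0 < qroot \<beta> 3"
    by simp_all
qed

end

theory Submission
  imports Defs
begin

text \<open>
  For a 3-cycle \<open>(x, y, z)\<close> of \<open>g\<close> the divided differences \<open>p = a (x + y) + b\<close>,
  \<open>q = a (y + z) + b\<close>, \<open>r = a (z + x) + b\<close> satisfy \<open>1 + p + p q = 0\<close> and its cyclic
  variants, because \<open>y - z = p (x - y)\<close>, \<open>z - x = q (y - z)\<close> and the differences sum to zero.
  Hence \<open>p, q, r\<close> are the roots of \<open>Q \<beta>\<close> for \<open>\<beta> = p + q + r + 1\<close>, summing the equations of the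
  cycle gives \<open>\<beta>\<^sup>2 = \<delta>\<close>, and \<open>x\<close> is recovered from \<open>1 / p = q r = - 1 - q\<close>. Conversely, the map
  \<open>q \<mapsto> - (1 + q) / q\<close> of order three permutes the roots of \<open>Q \<beta>\<close> cyclically, and
  \<open>q \<mapsto> (- b + \<beta> + 1) / (2 a) + 1 / (a q)\<close> conjugates it to \<open>g\<close> whenever \<open>\<beta>\<^sup>2 = \<delta>\<close>.
\<close>

definition rot :: "real \<Rightarrow> real" where
  "rot q = - (1 + q) / q"

text \<open>The parameter \<open>\<beta>\<close> stands for any real square root of
  \<open>\<delta>\<close>, so one formula serves \<open>0\<close>, \<open>sqrt \<delta>\<close> and
  \<open>- sqrt \<delta>\<close>.\<close>

definition cycle_point :: "real \<Rightarrow> real \<Rightarrow> real \<Rightarrow> real \<Rightarrow> real" where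
  "cycle_point a b \<beta> q = (- b + \<beta> + 1) / (2 * a) + 1 / (a * q)"

definition root_triple :: "real \<Rightarrow> real \<Rightarrow> real \<Rightarrow> real \<Rightarrow> real \<times> real \<times> real" where
  "root_triple a b \<beta> q =
     (cycle_point a b \<beta> q, cycle_point a b \<beta> (rot q), cycle_point a b \<beta> (rot (rot q)))"

text \<open>Every root serves as a starting point, so no root has to be singled out.\<close>

definition root_cycle :: "real \<Rightarrow> real \<Rightarrow> real \<Rightarrow> (real \<times> real \<times> real) set" where
  "root_cycle a b \<beta> = root_triple a b \<beta> ` {q. poly (Q \<beta>) q = 0}"

section \<open>The action of \<open>rot\<close> on the roots of \<open>Q \<beta>\<close>\<close>

lemma Q_root_nonzero:
  assumes "poly (Q \<beta>) q = 0"
  shows "q \<noteq> 0" "q \<noteq> - 1"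
  using assms by (auto simp: poly_Q)

lemma Q_root_rot:
  assumes "poly (Q \<beta>) q = 0"
  shows "poly (Q \<beta>) (rot q) = 0"
proof -
  have q: "q \<noteq> 0" using Q_root_nonzero[OF assms] by simp
  then have "q * rot q = - (1 + q)" by (simp add: rot_def)
  \<comment> \<open>Clearing denominators reproduces the same cubic.\<close>
  then have "q ^ 3 * poly (Q \<beta>) (rot q) = poly (Q \<beta>) q"
    unfolding poly_Q by algebra
  with assms q show ?thesis by simp
qed

lemma rot_rot:
  assumes "q \<noteq> 0" "q \<noteq> - 1"
  shows "rot (rot q) = - 1 / (1 + q)"
proof -
  have "1 + q \<noteq> 0" using assms by linarith
  then show ?thesis using assms by (simp add: rot_def field_simps)
qed

lemma rot_rot_rot:
  assumes "q \<noteq> 0" "q \<noteq> - 1"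
  shows "rot (rot (rot q)) = q"
proof -
  have "1 + q \<noteq> 0" using assms by linarith
  then show ?thesis using assms by (simp add: rot_rot) (simp add: rot_def field_simps)
qed

text \<open>A fixed point would be a primitive cube root of unity, which is not real.\<close>

lemma rot_no_fixpoint:
  assumes "q \<noteq> 0"
  shows "rot q \<noteq> q"
proof
  assume "rot q = q"
  then have "q\<^sup>2 + q + 1 = 0"
    using assms by (simp add: rot_def field_simps power2_eq_square)
  moreover have "q\<^sup>2 + q + 1 = (q + 1 / 2)\<^sup>2 + 3 / 4"
    by (simp add: power2_eq_square field_simps)
  moreover have "(q + 1 / 2)\<^sup>2 \<ge> 0" by simp
  ultimately show False by linarith
qed

text \<open>Under a map of order three an orbit has one point or three, and fixed points are
  excluded.\<close>

lemma rot_orbit_distinct: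
  assumes "poly (Q \<beta>) q = 0"
  shows "rot q \<noteq> q" "rot (rot q) \<noteq> rot q" "rot (rot q) \<noteq> q"
proof -
  note nz = Q_root_nonzero[OF assms]
  show 1: "rot q \<noteq> q" using nz by (rule_tac rot_no_fixpoint)
  show "rot (rot q) \<noteq> rot q"
    using Q_root_nonzero[OF Q_root_rot[OF assms]] by (rule_tac rot_no_fixpoint)
  show "rot (rot q) \<noteq> q" using 1 rot_rot_rot[OF nz] by metis
qed

text \<open>The orbit already supplies three distinct roots, and a cubic has no more.\<close>

lemma Q_roots_eq_rot_orbit:
  assumes "poly (Q \<beta>) q = 0"
  shows "{t. poly (Q \<beta>) t = 0} = {q, rot q, rot (rot q)}"
proof -
  have nz: "Q \<beta> \<noteq> 0" and "degree (Q \<beta>) = 3" by (simp_all add: Q_def)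
  then have "card {t. poly (Q \<beta>) t = 0} \<le> 3" using card_poly_roots_bound[OF nz] by simp
  moreover have "card {q, rot q, rot (rot q)} = 3"
    using rot_orbit_distinct[OF assms] by auto
  moreover have "{q, rot q, rot (rot q)} \<subseteq> {t. poly (Q \<beta>) t = 0}"
    using assms Q_root_rot by auto
  ultimately show ?thesis
    using poly_roots_finite[OF nz] by (metis card_seteq)
qed

section \<open>From roots to 3-cycles\<close>

lemma cycle_point_inj:
  assumes "a \<noteq> 0"
  shows "cycle_point a b \<beta> q = cycle_point a b \<beta> r \<longleftrightarrow> q = r"
  using assms by (auto simp: cycle_point_def)

lemma scaled_cycle_point:
  assumes "a \<noteq> 0"
  shows "2 * a * cycle_point a b \<beta> q = - b + \<beta> + 1 + 2 * (1 / q)"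
  using assms by (simp add: cycle_point_def field_simps)

text \<open>In the coordinate \<open>u = 1 / q\<close> the condition on
  \<open>\<beta>\<^sup>2\<close> turns the quadratic map into
  \<open>u \<mapsto> u\<^sup>2 + (1 + \<beta>) * u - 2\<close>, while \<open>rot\<close> becomes
  \<open>u \<mapsto> - 1 / (1 + u)\<close>. The two agree at the reciprocals of the roots of
  \<open>Q \<beta>\<close>.\<close>

lemma quadratic_cycle_point:
  assumes "a \<noteq> 0" "\<beta>\<^sup>2 = b\<^sup>2 - 4 * a * c - 2 * b - 7" "poly (Q \<beta>) q = 0"
  shows "a * (cycle_point a b \<beta> q)\<^sup>2 + b * cycle_point a b \<beta> q + c = cycle_point a b \<beta> (rot q)"
proof -
  note nz = Q_root_nonzero[OF assms(3)]
  define u where "u = 1 / q"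
  define v where "v = 1 / rot q"
  have q1: "1 + q \<noteq> 0" using nz by linarith
  have uq: "u * q = 1" using nz by (simp add: u_def)
  have vq: "v * (1 + q) = - q" using q1 nz by (simp add: v_def rot_def field_simps)
  have "q ^ 2 * (1 + q) * (v + 2 - (1 + \<beta>) * u - u\<^sup>2) = poly (Q \<beta>) q"
    using uq vq unfolding poly_Q by algebra
  then have v: "v = u\<^sup>2 + (1 + \<beta>) * u - 2" using assms(3) nz q1 by simp
  define x y where "x = cycle_point a b \<beta> q" and "y = cycle_point a b \<beta> (rot q)"
  have "2 * a * x = - b + \<beta> + 1 + 2 * u" "2 * a * y = - b + \<beta> + 1 + 2 * v"
    unfolding x_def y_def u_def v_def by (rule scaled_cycle_point[OF assms(1)])+
  then have "4 * a * (a * x\<^sup>2 + b * x + c - y) = 0"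
    using assms(2) v by algebra
  with assms(1) show ?thesis by (simp add: x_def y_def)
qed

text \<open>By Vieta the reciprocals of the three roots sum to \<open>- (2 + \<beta>)\<close>. The
  resulting sum tells cycles with different \<open>\<beta>\<close> apart.\<close>

lemma root_triple_sum:
  assumes "a \<noteq> 0" "poly (Q \<beta>) q = 0" "root_triple a b \<beta> q = (x, y, z)"
  shows "2 * a * (x + y + z) = \<beta> - 1 - 3 * b"
proof -
  note nz = Q_root_nonzero[OF assms(2)]
  have q1: "1 + q \<noteq> 0" using nz by linarith
  define u v w where "u = 1 / q" and "v = 1 / rot q" and "w = 1 / rot (rot q)"
  have uq: "u * q = 1" using nz by (simp add: u_def)
  have vq: "v * (1 + q) = - q" using q1 nz by (simp add: v_def rot_def field_simps)
  have wq: "w = - 1 - q" using q1 by (simp add: w_def rot_rot[OF nz] field_simps)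
  have "q * (1 + q) * (u + v + w + 2 + \<beta>) = - poly (Q \<beta>) q"
    using uq vq wq unfolding poly_Q by algebra
  then have s: "u + v + w + 2 + \<beta> = 0" using assms(2) nz q1 by simp
  have "2 * a * (x + y + z) = 2 * a * cycle_point a b \<beta> q + 2 * a * cycle_point a b \<beta> (rot q)
      + 2 * a * cycle_point a b \<beta> (rot (rot q))"
    using assms(3) by (simp add: root_triple_def algebra_simps)
  also have "\<dots> = 3 * (- b + \<beta> + 1) + 2 * (u + v + w)"
    unfolding scaled_cycle_point[OF assms(1)] u_def v_def w_def by simp
  also have "\<dots> = \<beta> - 1 - 3 * b" using s by algebra
  finally show ?thesis .
qed

lemma root_triple_in_cyc3:
  assumes "a \<noteq> 0" "\<And>x. g x = a * x\<^sup>2 + b * x + c" "\<beta>\<^sup>2 = b\<^sup>2 - 4 * a * c - 2 * b - 7"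
    and "poly (Q \<beta>) q = 0"
  shows "root_triple a b \<beta> q \<in> cyc3_triples g"
proof -
  have g: "g (cycle_point a b \<beta> t) = cycle_point a b \<beta> (rot t)" if "poly (Q \<beta>) t = 0" for t
    using quadratic_cycle_point[OF assms(1,3) that] assms(2) by simp
  note roots = assms(4) Q_root_rot[OF assms(4)] Q_root_rot[OF Q_root_rot[OF assms(4)]]
  show ?thesis
    unfolding root_triple_def cyc3_triples_def
    using rot_orbit_distinct[OF assms(4)]
    by (auto simp: cycle_point_inj[OF assms(1)] roots[THEN g] rot_rot_rot[OF Q_root_nonzero[OF assms(4)]])
qed

section \<open>From 3-cycles back to roots\<close>

lemma cyc3_difference_relation:
  fixes x y z :: real
  assumes "y - z = p * (x - y)" "z - x = q * (y - z)" "x \<noteq> y"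
  shows "1 + p + p * q = 0"
proof -
  have "(x - y) * (1 + p + p * q) = 0" using assms(1,2) by algebra
  with assms(3) show ?thesis by simp
qed

lemma cyc3_is_root_triple:
  assumes "a \<noteq> 0" and g: "\<And>x. g x = a * x\<^sup>2 + b * x + c" and xyz: "(x, y, z) \<in> cyc3_triples g"
  obtains \<beta> q where "\<beta>\<^sup>2 = b\<^sup>2 - 4 * a * c - 2 * b - 7" "poly (Q \<beta>) q = 0"
    "(x, y, z) = root_triple a b \<beta> q"
proof -
  have ne: "x \<noteq> y" "y \<noteq> z" "z \<noteq> x" and gx: "g x = y" "g y = z" "g z = x"
    using xyz by (auto simp: cyc3_triples_def)
  note e = gx[unfolded g]
  define p q r where "p = a * (x + y) + b" and "q = a * (y + z) + b" and "r = a * (z + x) + b"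
  have diff: "g s - g t = (a * (s + t) + b) * (s - t)" for s t
    unfolding g by algebra
  have d: "y - z = p * (x - y)" "z - x = q * (y - z)" "x - y = r * (z - x)"
    using diff[of x y] diff[of y z] diff[of z x] unfolding gx p_def q_def r_def .
  have rel: "1 + p + p * q = 0" "1 + q + q * r = 0" "1 + r + r * p = 0"
    using cyc3_difference_relation d ne by metis+
  have nz: "p \<noteq> 0" "q \<noteq> 0" "r \<noteq> 0" using d ne by auto
  have pqr: "p * q * r = 1" using rel by algebra
  define \<beta> where "\<beta> = p + q + r + 1"
  \<comment> \<open>Completing squares with \<open>2 * a * x + b = p - q + r\<close> and its cyclic
    variants leaves \<open>- 8\<close> times the pairwise products of \<open>p\<close>,
    \<open>q\<close>, \<open>r\<close>; the relations with weight 8 cancel these.\<close>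
  have "3 * (\<beta>\<^sup>2 - (b\<^sup>2 - 4 * a * c - 2 * b - 7))
      = 4 * a * ((a * x\<^sup>2 + b * x + c - y) + (a * y\<^sup>2 + b * y + c - z) + (a * z\<^sup>2 + b * z + c - x))
        + 8 * ((1 + p + p * q) + (1 + q + q * r) + (1 + r + r * p))"
    unfolding \<beta>_def p_def q_def r_def by algebra
  also have "\<dots> = 0" using e rel by simp
  finally have \<beta>2: "\<beta>\<^sup>2 = b\<^sup>2 - 4 * a * c - 2 * b - 7" by simp
  \<comment> \<open>Vieta: the roots sum to \<open>\<beta> - 1\<close> by the choice of
    \<open>\<beta>\<close>, the relations add up to
    \<open>p * q + q * r + r * p = - (2 + \<beta>)\<close>, and the product is 1.\<close>
  have Qp: "poly (Q \<beta>) p = 0"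
    using rel pqr unfolding \<beta>_def poly_Q by algebra
  have rot: "rot p = q" "rot q = r"
    using rel nz by (simp_all add: rot_def field_simps)
  have inv: "1 / p = - 1 - q" "1 / q = - 1 - r" "1 / r = - 1 - p"
    using rel pqr nz by (simp_all add: field_simps; algebra)+
  \<comment> \<open>After substituting the reciprocals, the right-hand side for \<open>p\<close> is
    \<open>p - q + r - b\<close>, in which \<open>y\<close> and \<open>z\<close> cancel.\<close>
  have "2 * a * cycle_point a b \<beta> p = 2 * a * x" "2 * a * cycle_point a b \<beta> q = 2 * a * y"
    "2 * a * cycle_point a b \<beta> r = 2 * a * z"
    unfolding scaled_cycle_point[OF assms(1)] inv by (simp_all add: \<beta>_def p_def q_def r_def algebra_simps)
  then have "(x, y, z) = root_triple a b \<beta> p"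
    using assms(1) rot by (simp add: root_triple_def)
  with \<beta>2 Qp that show thesis by blast
qed

section \<open>Cyclic classes and their number\<close>

text \<open>The other two roots are \<open>rot q\<close> and \<open>rot (rot q)\<close>, and
  starting from them only rotates the triple.\<close>

lemma cyclic_class_root_triple:
  assumes "poly (Q \<beta>) q = 0"
  shows "cyclic_rel `` {root_triple a b \<beta> q} = root_cycle a b \<beta>"
proof -
  note nz = Q_root_nonzero[OF assms]
  have "rot (rot (rot (rot q))) = rot q" using rot_rot_rot[OF nz] by simp
  then show ?thesis
    unfolding root_cycle_def Q_roots_eq_rot_orbit[OF assms]
    by (auto simp: cyclic_rel_def root_triple_def rot_rot_rot[OF nz])
qed

lemma root_cycle_nonempty: "root_cycle a b \<beta> \<noteq> {}"
  using qroot_roots[of \<beta>] by (auto simp: root_cycle_def)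

text \<open>All triples of a cycle have the same component sum, and that sum determines
  \<open>\<beta>\<close>.\<close>

lemma root_cycle_inj:
  assumes "a \<noteq> 0" "root_cycle a b \<beta> = root_cycle a b \<gamma>"
  shows "\<beta> = \<gamma>"
proof -
  have sum: "2 * a * (x + y + z) = \<alpha> - 1 - 3 * b" if "(x, y, z) \<in> root_cycle a b \<alpha>" for x y z \<alpha>
    using that root_triple_sum[OF assms(1), of \<alpha> _ b x y z] unfolding root_cycle_def by auto
  obtain x y z where "(x, y, z) \<in> root_cycle a b \<beta>" using root_cycle_nonempty by fastforce
  moreover from this have "(x, y, z) \<in> root_cycle a b \<gamma>" unfolding assms(2) .
  ultimately show ?thesis using sum[of x y z \<beta>] sum[of x y z \<gamma>] by linarith
qed

lemma cycle_points_root_cycle: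
  "cycle_points (root_cycle a b \<beta>) =
     {(- b + \<beta> + 1) / (2 * a) + 1 / (a * qroot \<beta> i) | i. i \<in> {1, 2, 3}}"
proof -
  \<comment> \<open>Each root yields a first component, and \<open>rot\<close> contributes only
    further roots.\<close>
  have "cycle_points (root_cycle a b \<beta>) = cycle_point a b \<beta> ` {q. poly (Q \<beta>) q = 0}"
    using Q_root_rot by (fastforce simp: cycle_points_def root_cycle_def root_triple_def)
  then show ?thesis unfolding qroot_roots by (auto simp: cycle_point_def)
qed

text \<open>Together with injectivity in \<open>\<beta>\<close>, this reduces counting 3-cycles to
  counting real square roots of \<open>\<delta>\<close>.\<close>

lemma three_cycles_quadratic:
  assumes "a \<noteq> 0" "\<And>x. g x = a * x\<^sup>2 + b * x + c"
  shows "three_cycles g = root_cycle a b ` {\<beta>. \<beta>\<^sup>2 = b\<^sup>2 - 4 * a * c - 2 * b - 7}"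
proof (intro equalityI subsetI)
  fix C assume "C \<in> three_cycles g"
  then obtain x y z where xyz: "(x, y, z) \<in> cyc3_triples g" and C: "C = cyclic_rel `` {(x, y, z)}"
    by (auto simp: three_cycles_def quotient_def)
  obtain \<beta> q where "\<beta>\<^sup>2 = b\<^sup>2 - 4 * a * c - 2 * b - 7" "poly (Q \<beta>) q = 0"
    "(x, y, z) = root_triple a b \<beta> q"
    using cyc3_is_root_triple[OF assms xyz] .
  with C show "C \<in> root_cycle a b ` {\<beta>. \<beta>\<^sup>2 = b\<^sup>2 - 4 * a * c - 2 * b - 7}"
    by (simp add: cyclic_class_root_triple)
next
  fix C assume "C \<in> root_cycle a b ` {\<beta>. \<beta>\<^sup>2 = b\<^sup>2 - 4 * a * c - 2 * b - 7}"
  then obtain \<beta> where \<beta>: "\<beta>\<^sup>2 = b\<^sup>2 - 4 * a * c - 2 * b - 7" and C: "C = root_cycle a b \<beta>" by auto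
  \<comment> \<open>Any root would do, since the class does not depend on it.\<close>
  have root: "poly (Q \<beta>) (qroot \<beta> 1) = 0" using qroot_roots by blast
  show "C \<in> three_cycles g"
    unfolding three_cycles_def C cyclic_class_root_triple[OF root, symmetric]
    by (rule quotientI) (rule root_triple_in_cyc3[OF assms \<beta> root])
qed

theorem theorem2p3:
  fixes a b c \<delta> :: real and g :: "real \<Rightarrow> real"
  assumes "a \<noteq> 0"
    and "\<And>x. g x = a * x\<^sup>2 + b * x + c"
    and "\<delta> = b\<^sup>2 - 4 * a * c - 2 * b - 7"
  shows "(\<delta> < 0 \<longrightarrow> three_cycles g = {}) \<and>
    (\<delta> = 0 \<longrightarrow>
      (\<exists>C. three_cycles g = {C} \<and>
         cycle_points C = {(- b + 1) / (2 * a) + 1 / (a * qroot 0 i) | i. i \<in> {1, 2, 3}})) \<and>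
    (\<delta> > 0 \<longrightarrow>
      (\<exists>C\<^sub>1 C\<^sub>2. C\<^sub>1 \<noteq> C\<^sub>2 \<and> three_cycles g = {C\<^sub>1, C\<^sub>2} \<and>
         cycle_points C\<^sub>1 =
           {(- b + sqrt \<delta> + 1) / (2 * a) + 1 / (a * qroot (sqrt \<delta>) i) | i. i \<in> {1, 2, 3}} \<and>
         cycle_points C\<^sub>2 =
           {(- b - sqrt \<delta> + 1) / (2 * a) + 1 / (a * qroot (- sqrt \<delta>) i) | i. i \<in> {1, 2, 3}}))"
proof -
  have cycles: "three_cycles g = root_cycle a b ` {\<beta>. \<beta>\<^sup>2 = \<delta>}"
    using three_cycles_quadratic[OF assms(1,2)] assms(3) by simp
  have "three_cycles g = {}" if "\<delta> < 0"
  proof -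
    have "\<beta>\<^sup>2 \<noteq> \<delta>" for \<beta> :: real using that zero_le_power2[of \<beta>] by linarith
    then show ?thesis by (simp add: cycles)
  qed
  moreover have "\<exists>C. three_cycles g = {C} \<and>
      cycle_points C = {(- b + 1) / (2 * a) + 1 / (a * qroot 0 i) | i. i \<in> {1, 2, 3}}" if "\<delta> = 0"
    using that cycle_points_root_cycle[of a b 0]
    by (intro exI[of _ "root_cycle a b 0"]) (simp add: cycles)
  moreover have "\<exists>C\<^sub>1 C\<^sub>2. C\<^sub>1 \<noteq> C\<^sub>2 \<and> three_cycles g = {C\<^sub>1, C\<^sub>2} \<and>
      cycle_points C\<^sub>1 =
        {(- b + sqrt \<delta> + 1) / (2 * a) + 1 / (a * qroot (sqrt \<delta>) i) | i. i \<in> {1, 2, 3}} \<and>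
      cycle_points C\<^sub>2 =
        {(- b - sqrt \<delta> + 1) / (2 * a) + 1 / (a * qroot (- sqrt \<delta>) i) | i. i \<in> {1, 2, 3}}"
    if "\<delta> > 0"
  proof (intro exI conjI)
    have "\<beta>\<^sup>2 = \<delta> \<longleftrightarrow> \<beta> = sqrt \<delta> \<or> \<beta> = - sqrt \<delta>" for \<beta>
      using that power2_eq_iff[of \<beta> "sqrt \<delta>"] by simp
    then have "{\<beta>. \<beta>\<^sup>2 = \<delta>} = {sqrt \<delta>, - sqrt \<delta>}" by auto
    then show "three_cycles g = {root_cycle a b (sqrt \<delta>), root_cycle a b (- sqrt \<delta>)}"
      by (simp add: cycles)
    show "root_cycle a b (sqrt \<delta>) \<noteq> root_cycle a b (- sqrt \<delta>)"
    proof
      assume "root_cycle a b (sqrt \<delta>) = root_cycle a b (- sqrt \<delta>)"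
      then have "sqrt \<delta> = - sqrt \<delta>" by (rule root_cycle_inj[OF assms(1)])
      with that show False by simp
    qed
    show "cycle_points (root_cycle a b (sqrt \<delta>)) =
        {(- b + sqrt \<delta> + 1) / (2 * a) + 1 / (a * qroot (sqrt \<delta>) i) | i. i \<in> {1, 2, 3}}"
      by (rule cycle_points_root_cycle)
    show "cycle_points (root_cycle a b (- sqrt \<delta>)) =
        {(- b - sqrt \<delta> + 1) / (2 * a) + 1 / (a * qroot (- sqrt \<delta>) i) | i. i \<in> {1, 2, 3}}"
      using cycle_points_root_cycle[of a b "- sqrt \<delta>"] by simp
  qed
  ultimately show ?thesis by blast
qed

end
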